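(* Let $R$ be a (unital associative) algebra over a commutative ring $\mathfrak k$ and let $I\lhd R$ be a transfinitely nilpotent two-sided ideal. Then the rational closure $R^{\rm rat}_I\subseteq \hat R$ is the set of all entries of the unique solutions $Z\in\hat R^{\,l}$ (columns) of equations $Z=P+QZ$, where $l$ runs over the positive integers, $P$ runs over columns of length $l$ with entries in $R$, and $Q$ runs over $M_l(I)$. Symmetrically, $R^{\rm rat}_I$ is the set of all entries of the unique solutions in $\hat R$ (rows) of equations $Z=P+ZQ$, where $l$ runs over the positive integers, $P$ runs over rows of length $l$ with entries in $R$, and $Q\in M_l(I)$.
   Context: An ideal $I$ is transfinitely nilpotent if $\bigcap_{m\ge1}I^m=0$. $\hat R=\varprojlim R/I^m$ is the $I$-adic completion of $R$, which contains $R$; $\hat I$ is the closure of $I$ in $\hat R$, i.e. the kernel of $\hat R\to R/I$. Every $r\in\hat I$ has a quasi-inverse $r^+=\sum_{m\ge1}r^m\in\hat R$, i.e. the unique element $s$ with $s=r+rs=r+sr$. The rational closure $R^{\rm rat}_I$ is the smallest subalgebra of $\hat R$ that contains $R$ and is closed under taking quasi-inverses of its elements lying in $\hat I$. $M_l(I)$ is the set of $l\times l$ matrices with entries in $I$; for such $Q$ the matrix $1-Q$ is invertible over $\hat R$, so the equations above have unique solutions in $\hat R$. *)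

theory Defs
  imports "HOL-Algebra.Algebra"
begin

text \<open>
  The library's locale \<open>algebra\<close> assumes a commutative ring; here only the scalars commute.
\<close>

locale assoc_algebra = module K R + ring R for K and R (structure) +
  assumes smult_mult_left:
      "\<lbrakk>a \<in> carrier K; x \<in> carrier R; y \<in> carrier R\<rbrakk> \<Longrightarrow>
        (a \<odot> x) \<otimes> y = a \<odot> (x \<otimes> y)"
    and smult_mult_right:
      "\<lbrakk>a \<in> carrier K; x \<in> carrier R; y \<in> carrier R\<rbrakk> \<Longrightarrow>
        x \<otimes> (a \<odot> y) = a \<odot> (x \<otimes> y)"

definition is_subalgebra ::
    "'a set \<Rightarrow> ('k, 'c) ring_scheme \<Rightarrow> ('k, 'a, 'm) module_scheme \<Rightarrow> bool" where
  "is_subalgebra S K A \<longleftrightarrow> subring S A \<and> submodule S K A"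

fun ideal_power :: "('a, 'm) ring_scheme \<Rightarrow> 'a set \<Rightarrow> nat \<Rightarrow> 'a set" where
  "ideal_power R I 0 = carrier R"
| "ideal_power R I (Suc 0) = I"
| "ideal_power R I (Suc (Suc m)) = ideal_prod R (ideal_power R I (Suc m)) I"

definition transfinitely_nilpotent :: "('a, 'm) ring_scheme \<Rightarrow> 'a set \<Rightarrow> bool" where
  "transfinitely_nilpotent R I \<longleftrightarrow> (\<Inter>m\<in>{1..}. ideal_power R I m) = {\<zero>\<^bsub>R\<^esub>}"

text \<open>
  Elements of the inverse limit are families of cosets \<open>x m \<in> R/I\<^sup>m\<close>. The transition map
  \<open>R/I\<^sup>n \<rightarrow> R/I\<^sup>m\<close> for \<open>m \<le> n\<close> is \<open>C \<mapsto> I\<^sup>m + C\<close>, and a scalar acts on \<open>R/I\<^sup>m\<close> by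
  \<open>C \<mapsto> I\<^sup>m + a C\<close>. The index \<open>m = 0\<close> is harmless, since \<open>R/I\<^sup>0 = R/R\<close> is a single coset.
\<close>

definition completion ::
    "('k, 'a, 'm) module_scheme \<Rightarrow> 'a set \<Rightarrow> ('k, nat \<Rightarrow> 'a set) module" where
  "completion R I =
    \<lparr>carrier = {x. (\<forall>m. x m \<in> carrier (R Quot ideal_power R I m)) \<and>
                   (\<forall>m n. m \<le> n \<longrightarrow> x m = ideal_power R I m <+>\<^bsub>R\<^esub> x n)},
     monoid.mult = (\<lambda>x y m. x m \<otimes>\<^bsub>R Quot ideal_power R I m\<^esub> y m),
     one = (\<lambda>m. \<one>\<^bsub>R Quot ideal_power R I m\<^esub>),
     ring.zero = (\<lambda>m. \<zero>\<^bsub>R Quot ideal_power R I m\<^esub>),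
     add = (\<lambda>x y m. x m \<oplus>\<^bsub>R Quot ideal_power R I m\<^esub> y m),
     smult = (\<lambda>a x m. ideal_power R I m <+>\<^bsub>R\<^esub> ((\<lambda>r. a \<odot>\<^bsub>R\<^esub> r) ` x m))\<rparr>"

definition to_completion ::
    "('k, 'a, 'm) module_scheme \<Rightarrow> 'a set \<Rightarrow> 'a \<Rightarrow> nat \<Rightarrow> 'a set" where
  "to_completion R I r = (\<lambda>m. ideal_power R I m +>\<^bsub>R\<^esub> r)"

text \<open>
  Evaluation at index 1 is the projection \<open>completion R I \<rightarrow> R/I\<close>, because \<open>ideal_power R I 1 = I\<close>.
\<close>

definition ideal_closure ::
    "('k, 'a, 'm) module_scheme \<Rightarrow> 'a set \<Rightarrow> (nat \<Rightarrow> 'a set) set" where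
  "ideal_closure R I = a_kernel (completion R I) (R Quot I) (\<lambda>x. x 1)"

definition quasi_inverse :: "('a, 'm) ring_scheme \<Rightarrow> 'a \<Rightarrow> 'a" where
  "quasi_inverse A r =
    (THE s. s \<in> carrier A \<and> s = r \<oplus>\<^bsub>A\<^esub> r \<otimes>\<^bsub>A\<^esub> s \<and> s = r \<oplus>\<^bsub>A\<^esub> s \<otimes>\<^bsub>A\<^esub> r)"

definition rational_closure ::
    "('k, 'c) ring_scheme \<Rightarrow> ('k, 'a, 'm) module_scheme \<Rightarrow> 'a set \<Rightarrow> (nat \<Rightarrow> 'a set) set" where
  "rational_closure K R I =
    \<Inter>{S. is_subalgebra S K (completion R I) \<and>
        to_completion R I ` carrier R \<subseteq> S \<and>
        (\<forall>r \<in> S \<inter> ideal_closure R I. quasi_inverse (completion R I) r \<in> S)}"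

text \<open>
  Vectors and matrices of size \<open>l\<close> are functions on \<open>{..<l}\<close>; solutions are required to be
  extensional there, so that uniqueness of a solution is meaningful.
\<close>

definition column_solution ::
    "('k, 'a, 'm) module_scheme \<Rightarrow> 'a set \<Rightarrow> nat \<Rightarrow> (nat \<Rightarrow> 'a) \<Rightarrow> (nat \<Rightarrow> nat \<Rightarrow> 'a) \<Rightarrow>
      (nat \<Rightarrow> nat \<Rightarrow> 'a set) \<Rightarrow> bool" where
  "column_solution R I l P Q Z \<longleftrightarrow>
    Z \<in> {..<l} \<rightarrow>\<^sub>E carrier (completion R I) \<and>
    (\<forall>i<l. Z i = to_completion R I (P i) \<oplus>\<^bsub>completion R I\<^esub>
      (\<Oplus>\<^bsub>completion R I\<^esub>j\<in>{..<l}. to_completion R I (Q i j) \<otimes>\<^bsub>completion R I\<^esub> Z j))"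

definition row_solution ::
    "('k, 'a, 'm) module_scheme \<Rightarrow> 'a set \<Rightarrow> nat \<Rightarrow> (nat \<Rightarrow> 'a) \<Rightarrow> (nat \<Rightarrow> nat \<Rightarrow> 'a) \<Rightarrow>
      (nat \<Rightarrow> nat \<Rightarrow> 'a set) \<Rightarrow> bool" where
  "row_solution R I l P Q Z \<longleftrightarrow>
    Z \<in> {..<l} \<rightarrow>\<^sub>E carrier (completion R I) \<and>
    (\<forall>i<l. Z i = to_completion R I (P i) \<oplus>\<^bsub>completion R I\<^esub>
      (\<Oplus>\<^bsub>completion R I\<^esub>j\<in>{..<l}. Z j \<otimes>\<^bsub>completion R I\<^esub> to_completion R I (Q j i)))"

end

theory Submission
  imports Defs
begin

text \<open>
  Let \<open>A\<close> be the completion, \<open>J\<close> the closure of the ideal and \<open>B\<close> the image of \<open>R\<close>, so that the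
  image of \<open>I\<close> is \<open>B \<inter> J\<close>. Only one property of the completion matters: every element of \<open>J\<close> has
  a quasi-inverse. Hence \<open>1 - q\<close> is invertible for \<open>q \<in> J\<close>, and a system \<open>Z = P + Q Z\<close> over \<open>J\<close>
  can be solved by eliminating one unknown after another. This gives existence and uniqueness, and it
  shows that the solutions lie in every rationally closed subring containing the coefficients.
  Conversely, the entries of solutions form a rationally closed subring: entries of finite sets
  \<open>V \<subseteq> B + (B \<inter> J) V\<close> are stable under sums, under products (adjoin \<open>V y\<close> to the set of \<open>y\<close>) and
  under quasi-inverses (pass to \<open>V (1 - z)\<^sup>-\<^sup>1\<close>). Rows are columns over the opposite ring.
\<close>

section \<open>Linear systems over a quasi-regular ideal\<close>

text \<open>Formulated over an arbitrary ring, so that it can also be read in the opposite ring.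
  Extensionality of \<open>Z\<close> is left to the statements where it matters.\<close>

definition linear_solution ::
    "('a, 'm) ring_scheme \<Rightarrow> nat \<Rightarrow> (nat \<Rightarrow> 'a) \<Rightarrow> (nat \<Rightarrow> nat \<Rightarrow> 'a) \<Rightarrow> (nat \<Rightarrow> 'a) \<Rightarrow> bool" where
  "linear_solution A l P Q Z \<longleftrightarrow>
    (\<forall>i<l. Z i = P i \<oplus>\<^bsub>A\<^esub> (\<Oplus>\<^bsub>A\<^esub>j\<in>{..<l}. Q i j \<otimes>\<^bsub>A\<^esub> Z j))"

lemma (in ring) linear_solution_cong:
  assumes "P' \<in> {..<l} \<rightarrow> carrier R" "Q' \<in> {..<l} \<rightarrow> {..<l} \<rightarrow> carrier R" "Z' \<in> {..<l} \<rightarrow> carrier R"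
    and "\<And>i. i < l \<Longrightarrow> P i = P' i" "\<And>i j. i < l \<Longrightarrow> j < l \<Longrightarrow> Q i j = Q' i j"
    and "\<And>i. i < l \<Longrightarrow> Z i = Z' i"
  shows "linear_solution R l P Q Z \<longleftrightarrow> linear_solution R l P' Q' Z'"
proof -
  have "(\<Oplus>j\<in>{..<l}. Q i j \<otimes> Z j) = (\<Oplus>j\<in>{..<l}. Q' i j \<otimes> Z' j)" if "i < l" for i
    using assms that by (intro finsum_cong') (auto simp: Pi_iff)
  then show ?thesis using assms by (simp add: linear_solution_def)
qed

text \<open>Subrings stand in for subalgebras: when \<open>B\<close> is the image of
  \<open>R\<close> in the completion, closure under scalars follows.\<close>

definition rationally_closed :: "('a, 'm) ring_scheme \<Rightarrow> 'a set \<Rightarrow> 'a set \<Rightarrow> 'a set \<Rightarrow> bool" where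
  "rationally_closed A J B S \<longleftrightarrow>
    subring S A \<and> B \<subseteq> S \<and> (\<forall>r \<in> S \<inter> J. quasi_inverse A r \<in> S)"

definition solution_entries :: "('a, 'm) ring_scheme \<Rightarrow> 'a set \<Rightarrow> 'a set \<Rightarrow> 'a set" where
  "solution_entries A J B =
    {Z i | l P Q Z i. P \<in> {..<l} \<rightarrow> B \<and> Q \<in> {..<l} \<rightarrow> {..<l} \<rightarrow> B \<inter> J \<and>
       Z \<in> {..<l} \<rightarrow> carrier A \<and> linear_solution A l P Q Z \<and> i < l}"

text \<open>For a subring \<open>B\<close> this is \<open>B + (B \<inter> J) V\<close>. Generating
  it inductively lets closure properties be proved rule by rule instead of on finite sums of
  coefficients.\<close>

inductive_set affine_span :: "('a, 'm) ring_scheme \<Rightarrow> 'a set \<Rightarrow> 'a set \<Rightarrow> 'a set \<Rightarrow> 'a set"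
  for A (structure) and J and B and V where
    base: "r \<in> B \<Longrightarrow> r \<in> affine_span A J B V"
  | gen: "\<lbrakk>q \<in> B; q \<in> J; v \<in> V\<rbrakk> \<Longrightarrow> q \<otimes> v \<in> affine_span A J B V"
  | add: "\<lbrakk>x \<in> affine_span A J B V; y \<in> affine_span A J B V\<rbrakk> \<Longrightarrow> x \<oplus> y \<in> affine_span A J B V"

text \<open>
  A finite set \<open>V\<close> with \<open>V \<subseteq> B + (B \<inter> J) V\<close> is a linear system together with its solution, with
  no reference to matrices.
\<close>

definition self_spanning :: "('a, 'm) ring_scheme \<Rightarrow> 'a set \<Rightarrow> 'a set \<Rightarrow> 'a set \<Rightarrow> bool" where
  "self_spanning A J B V \<longleftrightarrow> finite V \<and> V \<subseteq> carrier A \<and> V \<subseteq> affine_span A J B V"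

section \<open>Quasi-inverses and Gaussian elimination\<close>

locale quasi_regular_ideal = ideal J A for J and A (structure) +
  assumes quasi_regular: "x \<in> J \<Longrightarrow> \<exists>s\<in>carrier A. s = x \<oplus> x \<otimes> s \<and> s = x \<oplus> s \<otimes> x"
begin

text \<open>Expanding \<open>s t\<close> once with \<open>t = x + x t\<close> and once with
  \<open>s = x + s x\<close> gives \<open>s x = x t\<close>, hence \<open>s = t\<close>. This
  justifies the definite description in \<open>quasi_inverse\<close>.\<close>

lemma quasi_inverse_eqI:
  assumes x: "x \<in> carrier A" and s: "s \<in> carrier A" "s = x \<oplus> x \<otimes> s" "s = x \<oplus> s \<otimes> x"
  shows "quasi_inverse A x = s"
  unfolding quasi_inverse_def
proof (rule the_equality)
  show "s \<in> carrier A \<and> s = x \<oplus> x \<otimes> s \<and> s = x \<oplus> s \<otimes> x" using s by blast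
next
  fix t assume t: "t \<in> carrier A \<and> t = x \<oplus> x \<otimes> t \<and> t = x \<oplus> t \<otimes> x"
  have tc: "t \<in> carrier A" using t by blast
  have "s \<otimes> (x \<oplus> x \<otimes> t) = s \<otimes> x \<oplus> s \<otimes> x \<otimes> t"
    using x s(1) tc by (simp add: r_distr m_assoc)
  then have 1: "s \<otimes> t = s \<otimes> x \<oplus> s \<otimes> x \<otimes> t" using t by metis
  have "(x \<oplus> s \<otimes> x) \<otimes> t = x \<otimes> t \<oplus> s \<otimes> x \<otimes> t" using x s(1) tc by (simp add: l_distr)
  then have 2: "s \<otimes> t = x \<otimes> t \<oplus> s \<otimes> x \<otimes> t" using s(3) by metis
  have "s \<otimes> x = x \<otimes> t"
    using 1 2 x s(1) tc by (metis a_comm add.l_cancel m_closed)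
  then show "t = s" using t s(3) by metis
qed

lemma quasi_inverse:
  assumes "x \<in> J"
  shows "quasi_inverse A x \<in> carrier A"
    and "quasi_inverse A x = x \<oplus> x \<otimes> quasi_inverse A x"
    and "quasi_inverse A x = x \<oplus> quasi_inverse A x \<otimes> x"
proof -
  obtain s where s: "s \<in> carrier A" "s = x \<oplus> x \<otimes> s" "s = x \<oplus> s \<otimes> x"
    using quasi_regular[OF assms] by blast
  moreover have "quasi_inverse A x = s" using quasi_inverse_eqI s Icarr[OF assms] by blast
  ultimately show "quasi_inverse A x \<in> carrier A"
    "quasi_inverse A x = x \<oplus> x \<otimes> quasi_inverse A x"
    "quasi_inverse A x = x \<oplus> quasi_inverse A x \<otimes> x" by simp_all
qed

text \<open>Both sides say \<open>(1 - q) z = w\<close>, because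
  \<open>1 + quasi_inverse A q\<close> inverts \<open>1 - q\<close>.\<close>

lemma scalar_equation_iff:
  assumes q: "q \<in> J" and w: "w \<in> carrier A" and z: "z \<in> carrier A"
  shows "z = w \<oplus> q \<otimes> z \<longleftrightarrow> z = w \<oplus> quasi_inverse A q \<otimes> w"
proof -
  define s where "s = quasi_inverse A q"
  have s: "s \<in> carrier A" "s = q \<oplus> q \<otimes> s" "s = q \<oplus> s \<otimes> q"
    using quasi_inverse[OF q] unfolding s_def by blast+
  have qc: "q \<in> carrier A" using q by (rule Icarr)
  have "z = w \<oplus> q \<otimes> z" if "z = w \<oplus> s \<otimes> w"
  proof -
    have "q \<otimes> (w \<oplus> s \<otimes> w) = (q \<oplus> q \<otimes> s) \<otimes> w"
      using qc s(1) w by (simp add: r_distr l_distr m_assoc)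
    then show ?thesis using that s(2) by metis
  qed
  moreover have "z = w \<oplus> s \<otimes> w" if h: "z = w \<oplus> q \<otimes> z"
  proof -
    have "s \<otimes> z = (q \<oplus> s \<otimes> q) \<otimes> z" using s(3) by metis
    then have 1: "s \<otimes> z = q \<otimes> z \<oplus> s \<otimes> (q \<otimes> z)" using qc s(1) z by (simp add: l_distr m_assoc)
    have "s \<otimes> (w \<oplus> q \<otimes> z) = s \<otimes> w \<oplus> s \<otimes> (q \<otimes> z)" using qc s(1) w z by (simp add: r_distr)
    then have 2: "s \<otimes> z = s \<otimes> w \<oplus> s \<otimes> (q \<otimes> z)" using h by metis
    have "q \<otimes> z = s \<otimes> w"
      using 1 2 qc s(1) w z by (metis a_comm add.l_cancel m_closed)
    then show ?thesis using h by metis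
  qed
  ultimately show ?thesis unfolding s_def by blast
qed

lemma rationally_closed_carrier:
  assumes "B \<subseteq> carrier A"
  shows "rationally_closed A J B (carrier A)"
  using assms quasi_inverse(1) carrier_is_subring by (auto simp: rationally_closed_def)

text \<open>Gaussian elimination of the last unknown, whose coefficient \<open>1 - q\<close> is invertible over \<open>S\<close>.\<close>

lemma linear_solution_in_rationally_closed:
  assumes S: "rationally_closed A J B S"
    and P: "P \<in> {..<l} \<rightarrow> S" and Q: "Q \<in> {..<l} \<rightarrow> {..<l} \<rightarrow> S \<inter> J"
  shows "\<exists>Z \<in> {..<l} \<rightarrow> S. \<forall>Z' \<in> {..<l} \<rightarrow> carrier A.
           linear_solution A l P Q Z' \<longleftrightarrow> (\<forall>i<l. Z' i = Z i)"
  using P Q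
proof (induction l arbitrary: P Q)
  case 0
  then show ?case by (auto simp: linear_solution_def)
next
  case (Suc l)
  have subring: "subring S A" using S by (simp add: rationally_closed_def)
  note S_ops = subringE(2,6,7)[OF subring]
  have Sc: "\<And>x. x \<in> S \<Longrightarrow> x \<in> carrier A" using subringE(1)[OF subring] by blast
  have PS: "\<And>i. i \<le> l \<Longrightarrow> P i \<in> S" using Suc.prems(1) by auto
  have QS: "\<And>i j. i \<le> l \<Longrightarrow> j \<le> l \<Longrightarrow> Q i j \<in> S"
    and QJ: "\<And>i j. i \<le> l \<Longrightarrow> j \<le> l \<Longrightarrow> Q i j \<in> J"
    using Suc.prems(2) by (auto simp: Pi_iff less_Suc_eq_le)
  define s where "s = quasi_inverse A (Q l l)"
  have sS: "s \<in> S" using S QS QJ by (auto simp: s_def rationally_closed_def)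
  note in_S = PS QS sS S_ops
  note cl = in_S[THEN Sc]
  \<comment> \<open>The last equation gives \<open>Z l = w + s w\<close>, where \<open>w\<close> is
    \<open>P l\<close> plus the sum of the \<open>Q l j Z j\<close> with \<open>j < l\<close>.
    Inserting this into equation \<open>i\<close> produces the coefficients \<open>P'\<close> and
    \<open>Q'\<close>.\<close>
  define P' where "P' i = P i \<oplus> Q i l \<otimes> (P l \<oplus> s \<otimes> P l)" for i
  define Q' where "Q' i j = Q i j \<oplus> Q i l \<otimes> (Q l j \<oplus> s \<otimes> Q l j)" for i j
  have P': "P' \<in> {..<l} \<rightarrow> S" using in_S by (auto simp: P'_def)
  have Q': "Q' \<in> {..<l} \<rightarrow> {..<l} \<rightarrow> S \<inter> J"
    using in_S by (auto simp: Q'_def Pi_iff intro!: QJ a_closed I_r_closed cl)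
  obtain Z where Z: "Z \<in> {..<l} \<rightarrow> S"
    and Z_iff: "\<And>Z'. Z' \<in> {..<l} \<rightarrow> carrier A \<Longrightarrow>
                  linear_solution A l P' Q' Z' \<longleftrightarrow> (\<forall>i<l. Z' i = Z i)"
    using Suc.IH[OF P' Q'] by blast
  have sum_S: "(\<Oplus>j\<in>T. f j) \<in> S" if "finite T" "f \<in> T \<rightarrow> S" for T and f :: "nat \<Rightarrow> 'a"
    using that
  proof (induction T rule: finite_induct)
    case (insert x F)
    then show ?case using Sc by (subst finsum_insert) (auto intro!: S_ops)
  qed (simp add: S_ops)
  \<comment> \<open>The right-hand side of the last equation without its diagonal term. It involves
    only unknowns below \<open>l\<close>, which the induction hypothesis determines.\<close>
  define W where "W Z' = P l \<oplus> (\<Oplus>j\<in>{..<l}. Q l j \<otimes> Z' j)" for Z'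
  define z where "z = W Z \<oplus> s \<otimes> W Z"
  have WS: "W Z \<in> S" using Z by (auto simp: W_def intro!: in_S sum_S)
  then have zS: "z \<in> S" using in_S by (simp add: z_def)
  show ?case
  proof (intro bexI[of _ "Z(l := z)"] ballI)
    show "Z(l := z) \<in> {..<Suc l} \<rightarrow> S" using Z zS by (auto simp: Pi_iff less_Suc_eq)
  next
    fix Z' assume Z': "Z' \<in> {..<Suc l} \<rightarrow> carrier A"
    then have Zc: "\<And>i. i \<le> l \<Longrightarrow> Z' i \<in> carrier A" by auto
    have Z'_l: "Z' \<in> {..<l} \<rightarrow> carrier A" using Z' by auto
    define U where "U i = (\<Oplus>j\<in>{..<l}. Q i j \<otimes> Z' j)" for i
    have U: "\<And>i. i \<le> l \<Longrightarrow> U i \<in> carrier A"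
      using cl Zc by (auto simp: U_def intro!: finsum_closed)
    have sum_Suc: "(\<Oplus>j\<in>{..<Suc l}. Q i j \<otimes> Z' j) = Q i l \<otimes> Z' l \<oplus> U i" if "i \<le> l" for i
      unfolding lessThan_Suc U_def using that cl Zc by (subst finsum_insert) auto
    have sum_Q': "(\<Oplus>j\<in>{..<l}. Q' i j \<otimes> Z' j) = U i \<oplus> (Q i l \<oplus> Q i l \<otimes> s) \<otimes> U l" if "i \<le> l" for i
    proof -
      have "(\<Oplus>j\<in>{..<l}. Q' i j \<otimes> Z' j)
          = (\<Oplus>j\<in>{..<l}. Q i j \<otimes> Z' j \<oplus> (Q i l \<oplus> Q i l \<otimes> s) \<otimes> (Q l j \<otimes> Z' j))"
        using that cl Zc
        by (intro finsum_cong') (auto simp: Q'_def l_distr r_distr m_assoc intro!: a_closed m_closed)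
      also have "\<dots> = U i \<oplus> (\<Oplus>j\<in>{..<l}. (Q i l \<oplus> Q i l \<otimes> s) \<otimes> (Q l j \<otimes> Z' j))"
        unfolding U_def using that cl Zc by (subst finsum_addf) auto
      also have "(\<Oplus>j\<in>{..<l}. (Q i l \<oplus> Q i l \<otimes> s) \<otimes> (Q l j \<otimes> Z' j))
          = (Q i l \<oplus> Q i l \<otimes> s) \<otimes> U l"
        unfolding U_def using that cl Zc by (subst finsum_rdistr) auto
      finally show ?thesis .
    qed
    have W': "W Z' = P l \<oplus> U l" by (simp add: W_def U_def)
    have last: "Z' l = P l \<oplus> (Q l l \<otimes> Z' l \<oplus> U l) \<longleftrightarrow> Z' l = W Z' \<oplus> s \<otimes> W Z'"
    proof -
      have "P l \<oplus> (Q l l \<otimes> Z' l \<oplus> U l) = W Z' \<oplus> Q l l \<otimes> Z' l"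
        using cl U Zc by (simp add: W' a_ac)
      then show ?thesis
        using scalar_equation_iff[of "Q l l" "W Z'" "Z' l"] cl U Zc QJ by (simp add: W' s_def)
    qed
    have eliminated: "P i \<oplus> (Q i l \<otimes> Z' l \<oplus> U i) = P' i \<oplus> (\<Oplus>j\<in>{..<l}. Q' i j \<otimes> Z' j)"
      if "i < l" "Z' l = W Z' \<oplus> s \<otimes> W Z'" for i
    proof -
      have "P i \<in> carrier A" "Q i l \<in> carrier A" "P l \<in> carrier A" "s \<in> carrier A"
        "U i \<in> carrier A" "U l \<in> carrier A" using that cl U by auto
      then have "P i \<oplus> (Q i l \<otimes> ((P l \<oplus> U l) \<oplus> s \<otimes> (P l \<oplus> U l)) \<oplus> U i) =
          P i \<oplus> Q i l \<otimes> (P l \<oplus> s \<otimes> P l) \<oplus> (U i \<oplus> (Q i l \<oplus> Q i l \<otimes> s) \<otimes> U l)"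
        by (simp add: l_distr r_distr m_assoc a_ac)
      then show ?thesis using that by (simp add: sum_Q' P'_def W')
    qed
    \<comment> \<open>Every step of the elimination is an equivalence, so that existence and
      uniqueness come out together.\<close>
    have "linear_solution A (Suc l) P Q Z' \<longleftrightarrow>
        (\<forall>i<l. Z' i = P i \<oplus> (Q i l \<otimes> Z' l \<oplus> U i)) \<and> Z' l = W Z' \<oplus> s \<otimes> W Z'"
      unfolding linear_solution_def using last by (auto simp: sum_Suc less_Suc_eq)
    also have "\<dots> \<longleftrightarrow> linear_solution A l P' Q' Z' \<and> Z' l = W Z' \<oplus> s \<otimes> W Z'"
      unfolding linear_solution_def using eliminated by auto
    also have "\<dots> \<longleftrightarrow> (\<forall>i<l. Z' i = Z i) \<and> Z' l = W Z' \<oplus> s \<otimes> W Z'"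
      using Z_iff[OF Z'_l] by simp
    also have "\<dots> \<longleftrightarrow> (\<forall>i<l. Z' i = Z i) \<and> Z' l = z"
    proof -
      have "W Z' = W Z" if "\<forall>i<l. Z' i = Z i"
        using that cl Sc Z unfolding W_def
        by (intro arg_cong2[of _ _ _ _ "(\<oplus>)"] finsum_cong') (auto simp: Pi_iff)
      then show ?thesis by (auto simp: z_def)
    qed
    also have "\<dots> \<longleftrightarrow> (\<forall>i<Suc l. Z' i = (Z(l := z)) i)" by (auto simp: less_Suc_eq)
    finally show "linear_solution A (Suc l) P Q Z' \<longleftrightarrow> (\<forall>i<Suc l. Z' i = (Z(l := z)) i)" .
  qed
qed

text \<open>Elimination with \<open>S = carrier A\<close> fixes the values below \<open>l\<close>,
  extensionality the others.\<close>

lemma ex1_linear_solution: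
  assumes "P \<in> {..<l} \<rightarrow> carrier A" and "Q \<in> {..<l} \<rightarrow> {..<l} \<rightarrow> J"
  shows "\<exists>!Z. Z \<in> {..<l} \<rightarrow>\<^sub>E carrier A \<and> linear_solution A l P Q Z"
proof -
  have "Q \<in> {..<l} \<rightarrow> {..<l} \<rightarrow> carrier A \<inter> J" using assms(2) Icarr by (auto simp: Pi_iff)
  from linear_solution_in_rationally_closed[OF rationally_closed_carrier[OF empty_subsetI]
      assms(1) this]
  obtain Z where Z: "Z \<in> {..<l} \<rightarrow> carrier A"
    and "\<forall>Z' \<in> {..<l} \<rightarrow> carrier A. linear_solution A l P Q Z' \<longleftrightarrow> (\<forall>i<l. Z' i = Z i)"
    by (rule bexE)
  note iff = bspec[OF this(2)]
  show ?thesis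
  proof (rule ex1I)
    show "restrict Z {..<l} \<in> {..<l} \<rightarrow>\<^sub>E carrier A \<and> linear_solution A l P Q (restrict Z {..<l})"
      using Z by (subst iff) auto
  next
    fix Z' assume Z': "Z' \<in> {..<l} \<rightarrow>\<^sub>E carrier A \<and> linear_solution A l P Q Z'"
    then have "\<forall>i<l. Z' i = Z i" using iff[of Z'] by (auto simp: PiE_iff)
    then show "Z' = restrict Z {..<l}" using Z' by (auto simp: PiE_iff extensional_def)
  qed
qed

end

section \<open>Affine spans and self-spanning sets\<close>

locale quasi_regular_ideal_subring = quasi_regular_ideal + B?: subring B A for B
begin

lemmas B_ops = subringE(2,3,5,6,7)[OF B.subring_axioms]

lemma B_carrier: "x \<in> B \<Longrightarrow> x \<in> carrier A"
  using subringE(1)[OF B.subring_axioms] by blast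

abbreviation span where "span \<equiv> affine_span A J B"

lemma span_carrier: "x \<in> span V \<Longrightarrow> V \<subseteq> carrier A \<Longrightarrow> x \<in> carrier A"
  by (induction rule: affine_span.induct) (auto intro: B_carrier Icarr)

lemma span_mono: "x \<in> span V \<Longrightarrow> V \<subseteq> W \<Longrightarrow> x \<in> span W"
  by (induction rule: affine_span.induct) (auto intro: affine_span.intros)

text \<open>Left multiplication by elements of \<open>B\<close> preserves both \<open>B\<close> and
  \<open>B \<inter> J\<close>, so constant terms and generators keep their kind.\<close>

lemma span_l_mult:
  assumes "x \<in> span V" "V \<subseteq> carrier A" "r \<in> B"
  shows "r \<otimes> x \<in> span V"
  using assms
proof (induction rule: affine_span.induct)
  case (gen q v)
  then have "(r \<otimes> q) \<otimes> v \<in> span V"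
    by (intro affine_span.gen B_ops I_l_closed) (auto intro: B_carrier)
  then show ?case using gen by (simp add: m_assoc B_carrier subsetD)
next
  case (add x y)
  then show ?case by (auto simp: r_distr B_carrier span_carrier intro: affine_span.add)
qed (auto intro: affine_span.base B_ops)

text \<open>Terms with the same \<open>v\<close> are collected, which leaves one coefficient for
  each element of \<open>V\<close>. This recovers the rows of a matrix from membership in the
  span.\<close>

lemma span_coefficients:
  assumes "x \<in> span V" "finite V" "V \<subseteq> carrier A"
  shows "\<exists>p\<in>B. \<exists>q\<in>V \<rightarrow> B \<inter> J. x = p \<oplus> (\<Oplus>v\<in>V. q v \<otimes> v)"
  using assms
proof (induction rule: affine_span.induct)
  case (base r)
  have "(\<Oplus>v\<in>V. \<zero> \<otimes> v) = (\<Oplus>v\<in>V. \<zero>)" using base by (intro finsum_cong') auto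
  then have "(\<Oplus>v\<in>V. \<zero> \<otimes> v) = \<zero>" by (simp add: finsum_zero)
  then show ?case
    using base B_carrier B_ops by (intro bexI[of _ r] bexI[of _ "\<lambda>_. \<zero>"]) auto
next
  case (gen q v)
  \<comment> \<open>The test is turned round to \<open>v = w\<close>, the form of the sum in
    \<open>add.finprod_singleton\<close>.\<close>
  have "(\<Oplus>w\<in>V. (if w = v then q else \<zero>) \<otimes> w) = (\<Oplus>w\<in>V. if v = w then q \<otimes> w else \<zero>)"
    using gen B_carrier by (intro finsum_cong') auto
  also have "\<dots> = q \<otimes> v"
    using gen B_carrier by (intro add.finprod_singleton) auto
  finally show ?case
    using gen B_carrier B_ops
    by (intro bexI[of _ \<zero>] bexI[of _ "\<lambda>w. if w = v then q else \<zero>"]) (auto simp: subset_iff)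
next
  case (add x y)
  then obtain p q p' q' where p: "p \<in> B" "p' \<in> B" and q: "q \<in> V \<rightarrow> B \<inter> J" "q' \<in> V \<rightarrow> B \<inter> J"
    and x: "x = p \<oplus> (\<Oplus>v\<in>V. q v \<otimes> v)" and y: "y = p' \<oplus> (\<Oplus>v\<in>V. q' v \<otimes> v)" by blast
  have qc: "q v \<in> carrier A" "q' v \<in> carrier A" "v \<in> carrier A" if "v \<in> V" for v
    using q that add.prems by (auto simp: Pi_iff Icarr)
  have "(\<Oplus>v\<in>V. (q v \<oplus> q' v) \<otimes> v) = (\<Oplus>v\<in>V. q v \<otimes> v \<oplus> q' v \<otimes> v)"
    using qc by (intro finsum_cong') (auto simp: l_distr)
  also have "\<dots> = (\<Oplus>v\<in>V. q v \<otimes> v) \<oplus> (\<Oplus>v\<in>V. q' v \<otimes> v)"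
    using qc by (intro finsum_addf) auto
  finally have "x \<oplus> y = (p \<oplus> p') \<oplus> (\<Oplus>v\<in>V. (q v \<oplus> q' v) \<otimes> v)"
    using p qc B_carrier by (simp add: x y a_ac finsum_closed)
  moreover have "(\<lambda>v. q v \<oplus> q' v) \<in> V \<rightarrow> B \<inter> J" using q B_ops by (auto simp: Pi_iff)
  moreover have "p \<oplus> p' \<in> B" using p by (rule B_ops)
  ultimately show ?case by (intro bexI[of _ "p \<oplus> p'"] bexI[of _ "\<lambda>v. q v \<oplus> q' v"])
qed

text \<open>The map \<open>f\<close> may repeat values, as the entries of a column may. It serves
  for a solution indexed by numbers and for the multiples \<open>v \<otimes> u\<close> of the
  elements of a set.\<close>

lemma span_of_coefficients:
  assumes "finite T" "p \<in> B" "q \<in> T \<rightarrow> B \<inter> J" "f \<in> T \<rightarrow> V" "V \<subseteq> carrier A"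
  shows "p \<oplus> (\<Oplus>j\<in>T. q j \<otimes> f j) \<in> span V"
proof -
  have "(\<Oplus>j\<in>T. q j \<otimes> f j) \<in> span V" using assms(1,3,4)
  proof (induction T rule: finite_induct)
    case empty
    then show ?case using B_ops by (auto intro: affine_span.base)
  next
    case (insert j T)
    then have "q j \<otimes> f j \<in> span V" by (auto intro: affine_span.gen)
    moreover have "(\<lambda>j. q j \<otimes> f j) \<in> insert j T \<rightarrow> carrier A"
      using insert.prems assms(5) Icarr by (auto simp: Pi_iff)
    ultimately show ?case using insert
      by (subst finsum_insert) (auto intro: affine_span.add)
  qed
  then show ?thesis using assms(2) by (auto intro: affine_span.intros)
qed

text \<open>The entries of a solution form a finite set inside its own span, equal entries being
  merged. Conversely, an enumeration of \<open>V\<close> arranges the coefficients of its elements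
  in a matrix over \<open>B \<inter> J\<close>.\<close>

lemma solution_entries_eq: "solution_entries A J B = \<Union>{V. self_spanning A J B V}"
proof (intro equalityI subsetI)
  fix x assume "x \<in> solution_entries A J B"
  then obtain l P Q Z i where P: "P \<in> {..<l} \<rightarrow> B" and Q: "Q \<in> {..<l} \<rightarrow> {..<l} \<rightarrow> B \<inter> J"
    and Z: "Z \<in> {..<l} \<rightarrow> carrier A" "linear_solution A l P Q Z" and i: "i < l" "x = Z i"
    unfolding solution_entries_def by blast
  have "Z k \<in> span (Z ` {..<l})" if "k < l" for k
  proof -
    have "P k \<oplus> (\<Oplus>j\<in>{..<l}. Q k j \<otimes> Z j) \<in> span (Z ` {..<l})"
      using P Q Z(1) that by (intro span_of_coefficients) auto
    then show ?thesis using Z(2) that unfolding linear_solution_def by metis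
  qed
  then have "self_spanning A J B (Z ` {..<l})" using Z(1) by (auto simp: self_spanning_def)
  then show "x \<in> \<Union>{V. self_spanning A J B V}" using i by blast
next
  fix x assume "x \<in> \<Union>{V. self_spanning A J B V}"
  then obtain V where x: "x \<in> V" and V: "finite V" "V \<subseteq> carrier A" "V \<subseteq> span V"
    by (auto simp: self_spanning_def)
  have "\<forall>v\<in>V. \<exists>p q. p \<in> B \<and> q \<in> V \<rightarrow> B \<inter> J \<and> v = p \<oplus> (\<Oplus>w\<in>V. q w \<otimes> w)"
    using span_coefficients[OF _ V(1,2)] V(3) by blast
  then have "\<exists>p q. \<forall>v\<in>V. p v \<in> B \<and> q v \<in> V \<rightarrow> B \<inter> J \<and> v = p v \<oplus> (\<Oplus>w\<in>V. q v w \<otimes> w)"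
    by (simp only: bchoice_iff)
  then obtain p q where p: "\<And>v. v \<in> V \<Longrightarrow> p v \<in> B" and q: "\<And>v. v \<in> V \<Longrightarrow> q v \<in> V \<rightarrow> B \<inter> J"
    and eq: "\<And>v. v \<in> V \<Longrightarrow> v = p v \<oplus> (\<Oplus>w\<in>V. q v w \<otimes> w)" by blast
  obtain Z where Z: "bij_betw Z {..<card V} V"
    using ex_bij_betw_nat_finite[OF V(1)] by (auto simp: atLeast0LessThan)
  have ZV: "\<And>i. i < card V \<Longrightarrow> Z i \<in> V" using Z by (auto simp: bij_betw_def)
  have "(\<Oplus>w\<in>V. q v w \<otimes> w) = (\<Oplus>j\<in>{..<card V}. q v (Z j) \<otimes> Z j)" if "v \<in> V" for v
  proof -
    have "(\<lambda>w. q v w \<otimes> w) \<in> Z ` {..<card V} \<rightarrow> carrier A"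
      using q[OF that] V(2) Icarr Z by (auto simp: bij_betw_def Pi_iff)
    then show ?thesis using finsum_reindex[of "\<lambda>w. q v w \<otimes> w" Z "{..<card V}"] Z
      by (simp add: bij_betw_def)
  qed
  then have "linear_solution A (card V) (\<lambda>i. p (Z i)) (\<lambda>i j. q (Z i) (Z j)) Z"
    unfolding linear_solution_def using eq ZV by metis
  moreover obtain i where "i < card V" "x = Z i" using x Z by (auto simp: bij_betw_def)
  moreover have "(\<lambda>i. p (Z i)) \<in> {..<card V} \<rightarrow> B" using p ZV by auto
  moreover have "(\<lambda>i j. q (Z i) (Z j)) \<in> {..<card V} \<rightarrow> {..<card V} \<rightarrow> B \<inter> J"
    using q ZV by (auto simp: Pi_iff)
  moreover have "Z \<in> {..<card V} \<rightarrow> carrier A" using ZV V(2) by auto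
  ultimately show "x \<in> solution_entries A J B" unfolding solution_entries_def by blast
qed

section \<open>The entries of solutions form a rationally closed subring\<close>

lemma solution_entries_spanI:
  assumes "self_spanning A J B V" "x \<in> span V"
  shows "x \<in> solution_entries A J B"
proof -
  have "self_spanning A J B (insert x V)"
    using assms span_carrier span_mono[of _ V "insert x V"]
    unfolding self_spanning_def by blast
  then show ?thesis unfolding solution_entries_eq by blast
qed

text \<open>In terms of matrices this is the block-diagonal sum of two systems.\<close>

lemma self_spanning_Un:
  assumes "self_spanning A J B V" "self_spanning A J B W"
  shows "self_spanning A J B (V \<union> W)"
  using assms span_mono[of _ V "V \<union> W"] span_mono[of _ W "V \<union> W"]
  by (auto simp: self_spanning_def)

text \<open>A generator \<open>q v\<close> becomes \<open>q (v y)\<close>, with the same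
  coefficient. A constant term \<open>r\<close> becomes \<open>r y\<close>, which may leave
  \<open>B\<close>; that it is spanned by \<open>W\<close> is therefore assumed, and checked
  separately for products and for quasi-inverses.\<close>

lemma span_r_mult:
  assumes "v \<in> span V" "V \<subseteq> carrier A" "y \<in> carrier A" "W \<subseteq> carrier A"
    and "\<And>r. r \<in> B \<Longrightarrow> r \<otimes> y \<in> span W" and "(\<lambda>v. v \<otimes> y) ` V \<subseteq> W"
  shows "v \<otimes> y \<in> span W"
  using assms
proof (induction rule: affine_span.induct)
  case (gen q v)
  then have "q \<otimes> (v \<otimes> y) \<in> span W" by (intro affine_span.gen) auto
  then show ?case using gen by (simp add: m_assoc B_carrier subsetD)
next
  case (add u v)
  then show ?case by (auto simp: l_distr span_carrier intro: affine_span.add)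
qed

lemma solution_entries_mult:
  assumes "x \<in> solution_entries A J B" "y \<in> solution_entries A J B"
  shows "x \<otimes> y \<in> solution_entries A J B"
proof -
  obtain U V where x: "x \<in> U" and U: "finite U" "U \<subseteq> carrier A" "U \<subseteq> span U"
    and y: "y \<in> V" and V: "finite V" "V \<subseteq> carrier A" "V \<subseteq> span V"
    using assms by (auto simp: solution_entries_eq self_spanning_def)
  \<comment> \<open>A constant term \<open>r\<close> of an element of \<open>U\<close> turns into
    \<open>r \<otimes> y\<close>, which lies in the span of \<open>V\<close> because
    \<open>y\<close> does; so \<open>V\<close> is kept beside the multiples of
    \<open>y\<close>.\<close>
  define W where "W = V \<union> (\<lambda>u. u \<otimes> y) ` U"
  have yc: "y \<in> carrier A" using y V by blast
  have W: "W \<subseteq> carrier A" using U V yc by (auto simp: W_def)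
  have ry: "r \<otimes> y \<in> span W" if "r \<in> B" for r
    using span_l_mult[of y V r] y V that span_mono[of _ V W] by (auto simp: W_def)
  have "u \<otimes> y \<in> span W" if "u \<in> U" for u
    using span_r_mult[of u U y W] U W yc ry that by (auto simp: W_def)
  then have "self_spanning A J B W"
    using U V W span_mono[of _ V W] by (auto simp: self_spanning_def W_def)
  moreover have "x \<otimes> y \<in> W" using x by (simp add: W_def)
  ultimately show ?thesis unfolding solution_entries_eq by blast
qed

text \<open>
  With \<open>u = 1 + z\<^sup>+ = (1 - z)\<^sup>-\<^sup>1\<close> one has \<open>z\<^sup>+ = z u\<close>. If \<open>z\<close> is an element of the self-spanning set
  \<open>V\<close>, then \<open>V u\<close> is self-spanning: the constant term \<open>r\<close> of \<open>v \<in> V\<close> becomes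
  \<open>r u = r + r z\<^sup>+\<close>, and \<open>z\<^sup>+\<close> is spanned because the constant term of \<open>z\<close> itself lies in \<open>J\<close>.
\<close>

lemma solution_entries_quasi_inverse:
  assumes "z \<in> solution_entries A J B" "z \<in> J"
  shows "quasi_inverse A z \<in> solution_entries A J B"
proof -
  obtain V where z: "z \<in> V" and V: "finite V" "V \<subseteq> carrier A" "V \<subseteq> span V"
    using assms by (auto simp: solution_entries_eq self_spanning_def)
  define s where "s = quasi_inverse A z"
  have s: "s \<in> carrier A" "s = z \<oplus> z \<otimes> s" 
    using quasi_inverse[OF assms(2)] unfolding s_def by blast+
  define u where "u = \<one> \<oplus> s"
  have u: "u \<in> carrier A" using s by (simp add: u_def)
  have zc: "z \<in> carrier A" using assms(2) by (rule Icarr)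
  have zu: "z \<otimes> u = s" using zc s by (simp add: u_def r_distr)
  define W where "W = (\<lambda>v. v \<otimes> u) ` V"
  have W: "W \<subseteq> carrier A" using V u by (auto simp: W_def)
  have sW: "s \<in> W" using z zu by (auto simp: W_def)
  obtain p q where p: "p \<in> B" and q: "q \<in> V \<rightarrow> B \<inter> J" and z_eq: "z = p \<oplus> (\<Oplus>v\<in>V. q v \<otimes> v)"
    using span_coefficients[of z V] z V by blast
  have qc: "q v \<in> carrier A" "q v \<in> J" "v \<in> carrier A" if "v \<in> V" for v
    using q that V Icarr by (auto simp: Pi_iff)
  have pc: "p \<in> carrier A" using p by (rule B_carrier)
  have sum_J: "(\<Oplus>v\<in>T. q v \<otimes> v) \<in> J" if "T \<subseteq> V" for T
  proof -
    have "finite T" using that V(1) finite_subset by blast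
    then show ?thesis using that
    proof (induction T rule: finite_induct)
      case (insert v T)
      then show ?case using qc by (subst finsum_insert) (auto intro!: a_closed I_r_closed)
    qed simp
  qed
  \<comment> \<open>Both \<open>z\<close> and its linear part lie in \<open>J\<close>, hence so does
    \<open>p\<close>, which can then act as a coefficient and not only as a constant term.\<close>
  have pJ: "p \<in> J"
  proof -
    have "p = z \<ominus> (\<Oplus>v\<in>V. q v \<otimes> v)"
      unfolding z_eq using pc Icarr[OF sum_J[OF subset_refl]]
      by (simp add: minus_eq a_assoc r_neg)
    then show ?thesis using assms(2) sum_J[OF subset_refl] by (simp add: minus_eq)
  qed
  have s_span: "s \<in> span W"
  proof -
    \<comment> \<open>Here \<open>s = z u\<close> is expanded along the coefficients of
      \<open>z\<close>. Splitting \<open>p u = p + p s\<close> leaves the generator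
      \<open>p s\<close> and an affine combination of \<open>W\<close> with constant term
      \<open>p\<close>.\<close>
    have "s = p \<otimes> u \<oplus> (\<Oplus>v\<in>V. q v \<otimes> v) \<otimes> u"
      using pc u Icarr[OF sum_J[OF subset_refl]] zu by (simp add: z_eq l_distr)
    also have "(\<Oplus>v\<in>V. q v \<otimes> v) \<otimes> u = (\<Oplus>v\<in>V. q v \<otimes> (v \<otimes> u))"
      using V(1) u qc by (subst finsum_ldistr) (auto simp: m_assoc intro!: finsum_cong')
    also have "p \<otimes> u \<oplus> \<dots> = p \<otimes> s \<oplus> (p \<oplus> (\<Oplus>v\<in>V. q v \<otimes> (v \<otimes> u)))"
    proof -
      have "(\<Oplus>v\<in>V. q v \<otimes> (v \<otimes> u)) \<in> carrier A" using u qc by (intro finsum_closed) auto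
      then show ?thesis using pc s(1) by (simp add: u_def r_distr a_ac)
    qed
    finally have eq: "s = p \<otimes> s \<oplus> (p \<oplus> (\<Oplus>v\<in>V. q v \<otimes> (v \<otimes> u)))" .
    have "p \<otimes> s \<in> span W" using p pJ sW by (rule affine_span.gen)
    moreover have "p \<oplus> (\<Oplus>v\<in>V. q v \<otimes> (v \<otimes> u)) \<in> span W"
      using V(1) p q W by (intro span_of_coefficients) (auto simp: W_def)
    ultimately have "p \<otimes> s \<oplus> (p \<oplus> (\<Oplus>v\<in>V. q v \<otimes> (v \<otimes> u))) \<in> span W"
      by (rule affine_span.add)
    then show ?thesis by (simp only: eq[symmetric])
  qed
  have ru: "r \<otimes> u \<in> span W" if "r \<in> B" for r
  proof -
    have "r \<otimes> u = r \<oplus> r \<otimes> s" using that s(1) by (simp add: u_def r_distr B_carrier)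
    then show ?thesis using that span_l_mult[OF s_span W that] by (auto intro: affine_span.intros)
  qed
  have "v \<otimes> u \<in> span W" if "v \<in> V" for v
    using span_r_mult[of v V u W] V W u ru that by (auto simp: W_def)
  then have "self_spanning A J B W" using V W by (auto simp: self_spanning_def W_def)
  then show ?thesis using sW unfolding solution_entries_eq s_def by blast
qed

lemma rationally_closed_solution_entries: "rationally_closed A J B (solution_entries A J B)"
  unfolding rationally_closed_def
proof (intro conjI ballI)
  \<comment> \<open>The span of the empty set contains \<open>B\<close>, so the elements of
    \<open>B\<close> are entries of solutions.\<close>
  have empty: "self_spanning A J B {}" by (simp add: self_spanning_def)
  show B: "B \<subseteq> solution_entries A J B"
    using solution_entries_spanI[OF empty] by (auto intro: affine_span.base)
  have sub: "solution_entries A J B \<subseteq> carrier A"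
    by (auto simp: solution_entries_eq self_spanning_def)
  show "subring (solution_entries A J B) A"
  proof (rule subringI)
    fix x assume x: "x \<in> solution_entries A J B"
    \<comment> \<open>Negation is multiplication by \<open>\<ominus> \<one>\<close>, an element of
      \<open>B\<close>.\<close>
    have "\<ominus> \<one> \<in> solution_entries A J B" using B B_ops(2,3) by blast
    then have "(\<ominus> \<one>) \<otimes> x \<in> solution_entries A J B" using x by (rule solution_entries_mult)
    then show "\<ominus> x \<in> solution_entries A J B" using x sub by (simp add: l_minus subsetD)
    fix y assume y: "y \<in> solution_entries A J B"
    show "x \<otimes> y \<in> solution_entries A J B" using x y by (rule solution_entries_mult)
    obtain U V where U: "x \<in> U" "self_spanning A J B U" and V: "y \<in> V" "self_spanning A J B V"
      using x y by (auto simp: solution_entries_eq)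
    then have "x \<in> span (U \<union> V)" "y \<in> span (U \<union> V)"
      using span_mono[of _ _ "U \<union> V"] unfolding self_spanning_def by blast+
    then show "x \<oplus> y \<in> solution_entries A J B"
      using solution_entries_spanI[OF self_spanning_Un[OF U(2) V(2)]] by (auto intro: affine_span.add)
  qed (use sub B B_ops(2) in blast)+
qed (auto intro: solution_entries_quasi_inverse)

text \<open>The set of entries is itself one of the sets intersected. Conversely, elimination inside
  any such \<open>S\<close> yields a solution over \<open>S\<close>, which by uniqueness is the
  given one.\<close>

theorem Inter_rationally_closed: "\<Inter>{S. rationally_closed A J B S} = solution_entries A J B"
proof
  show "\<Inter>{S. rationally_closed A J B S} \<subseteq> solution_entries A J B"
    using rationally_closed_solution_entries by blast
  show "solution_entries A J B \<subseteq> \<Inter>{S. rationally_closed A J B S}"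
  proof (intro subsetI InterI, clarify)
    fix x S assume x: "x \<in> solution_entries A J B" and S: "rationally_closed A J B S"
    obtain l P Q Z i where P: "P \<in> {..<l} \<rightarrow> B" and Q: "Q \<in> {..<l} \<rightarrow> {..<l} \<rightarrow> B \<inter> J"
      and Z: "Z \<in> {..<l} \<rightarrow> carrier A" "linear_solution A l P Q Z" and i: "i < l" "x = Z i"
      using x unfolding solution_entries_def by blast
    have "B \<subseteq> S" using S by (simp add: rationally_closed_def)
    then have "P \<in> {..<l} \<rightarrow> S" "Q \<in> {..<l} \<rightarrow> {..<l} \<rightarrow> S \<inter> J"
      using P Q by (auto simp: Pi_iff)
    then obtain Z' where "Z' \<in> {..<l} \<rightarrow> S"
      "\<forall>Z'' \<in> {..<l} \<rightarrow> carrier A. linear_solution A l P Q Z'' \<longleftrightarrow> (\<forall>i<l. Z'' i = Z' i)"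
      using linear_solution_in_rationally_closed[OF S] by blast
    then show "x \<in> S" using Z i by auto
  qed
qed

end

section \<open>The opposite ring\<close>

text \<open>Only the multiplication is replaced, so the additive structure and \<open>finsum\<close>
  carry over unchanged.\<close>

definition opposite :: "('a, 'm) ring_scheme \<Rightarrow> ('a, 'm) ring_scheme" where
  "opposite A = A\<lparr>monoid.mult := \<lambda>x y. y \<otimes>\<^bsub>A\<^esub> x\<rparr>"

lemma opposite_simps [simp]:
  "carrier (opposite A) = carrier A" "x \<otimes>\<^bsub>opposite A\<^esub> y = y \<otimes>\<^bsub>A\<^esub> x"
  "\<one>\<^bsub>opposite A\<^esub> = \<one>\<^bsub>A\<^esub>" "\<zero>\<^bsub>opposite A\<^esub> = \<zero>\<^bsub>A\<^esub>"
  "(\<oplus>\<^bsub>opposite A\<^esub>) = (\<oplus>\<^bsub>A\<^esub>)"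
  "finsum (opposite A) = finsum A"
  by (simp_all add: opposite_def finsum_def fun_eq_iff)

text \<open>The two defining equations exchange places.\<close>

lemma quasi_inverse_opposite [simp]: "quasi_inverse (opposite A) = quasi_inverse A"
  by (auto simp: quasi_inverse_def fun_eq_iff intro!: arg_cong[of _ _ The])

lemma subring_opposite [simp]: "subring S (opposite A) \<longleftrightarrow> subring S A"
  by (auto simp: subring_def submonoid_def)

lemma rationally_closed_opposite [simp]:
  "rationally_closed (opposite A) J B S \<longleftrightarrow> rationally_closed A J B S"
  by (simp add: rationally_closed_def)

lemma (in ring) ring_opposite: "ring (opposite R)"
proof (rule ringI)
  show "abelian_group (opposite R)"
    using abelian_group_axioms by (simp add: abelian_group_def abelian_monoid_def abelian_group_axioms_def)
  show "monoid (opposite R)" by (rule monoidI) (auto simp: m_assoc)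
qed (auto simp: l_distr r_distr)

text \<open>Two-sided ideals, subrings and the pair of quasi-inverse equations are left-right
  symmetric.\<close>

lemma (in quasi_regular_ideal_subring) opposite:
  "quasi_regular_ideal_subring J (opposite A) B"
proof -
  have "ideal J (opposite A)"
    by (rule idealI) (auto simp: ring_opposite a_subgroup I_l_closed I_r_closed)
  then show ?thesis
    using B.subring_axioms quasi_regular
    unfolding quasi_regular_ideal_subring_def quasi_regular_ideal_def quasi_regular_ideal_axioms_def
    by (simp add: conj_commute)
qed

section \<open>The completion\<close>

locale adic = ideal I R for I and R :: "('k, 'a, 'm) module_scheme" (structure)
begin

abbreviation pow where "pow \<equiv> ideal_power R I"
abbreviation A where "A \<equiv> completion R I"
abbreviation J where "J \<equiv> ideal_closure R I"
abbreviation \<iota> where "\<iota> \<equiv> to_completion R I"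

section \<open>Powers of the ideal and their cosets\<close>

lemma ideal_pow: "ideal (pow m) R"
proof (induction m rule: induct_nat_012)
  case 0
  then show ?case by (simp add: oneideal)
next
  case 1
  then show ?case by (simp add: ideal_axioms)
next
  case (ge2 m)
  then show ?case by (simp add: ideal_prod_is_ideal ideal_axioms)
qed

sublocale pow: ideal "pow m" R for m by (rule ideal_pow)

text \<open>For \<open>m = 0\<close> this is the ideal property of \<open>I\<close>, as
  \<open>pow 1\<close> is \<open>I\<close> by definition and not a product.\<close>

lemma pow_mult: "a \<in> pow m \<Longrightarrow> b \<in> I \<Longrightarrow> a \<otimes> b \<in> pow (Suc m)"
  by (cases m) (auto intro: I_l_closed ideal_prod.prod)

lemma pow_antimono: "m \<le> n \<Longrightarrow> pow n \<subseteq> pow m"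
proof (rule lift_Suc_antimono_le)
  show "pow (Suc k) \<subseteq> pow k" for k
    using ideal_prod_inter[OF ideal_pow[of k] ideal_axioms] pow.a_subset by (cases k) auto
qed

lemma coset_eq_iff:
  "a \<in> carrier R \<Longrightarrow> b \<in> carrier R \<Longrightarrow> pow m +> a = pow m +> b \<longleftrightarrow> a \<ominus> b \<in> pow m"
  using quotient_eq_iff_same_a_r_cos[OF ideal_pow] by blast

text \<open>Since \<open>pow n\<close> lies in \<open>pow m\<close>, it is absorbed: the transition
  map keeps representatives.\<close>

lemma transition_coset:
  assumes "m \<le> n" "r \<in> carrier R"
  shows "pow m <+>\<^bsub>R\<^esub> (pow n +> r) = pow m +> r"
proof
  show "pow m <+>\<^bsub>R\<^esub> (pow n +> r) \<subseteq> pow m +> r"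
  proof
    fix y assume "y \<in> pow m <+>\<^bsub>R\<^esub> (pow n +> r)"
    then obtain h k where h: "h \<in> pow m" and k: "k \<in> pow n" and y: "y = h \<oplus> (k \<oplus> r)"
      by (auto simp: set_add_def' a_r_coset_def')
    have km: "k \<in> pow m" using k pow_antimono[OF assms(1)] by blast
    have "y = (h \<oplus> k) \<oplus> r" using h km assms(2) by (simp add: y a_assoc pow.Icarr)
    moreover have "h \<oplus> k \<in> pow m" using h km by simp
    ultimately show "y \<in> pow m +> r" by (auto simp: a_r_coset_def')
  qed
  show "pow m +> r \<subseteq> pow m <+>\<^bsub>R\<^esub> (pow n +> r)"
    using pow.a_rcos_self[OF assms(2), of n]
    unfolding set_add_def' a_r_coset_def'[of R "pow m" r] by blast
qed

text \<open>
  Elements of the completion are handled through sequences of representatives, which are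
  Cauchy for the \<open>I\<close>-adic topology.
\<close>

definition cauchy where
  "cauchy r \<longleftrightarrow> (\<forall>m. r m \<in> carrier R) \<and> (\<forall>m n. m \<le> n \<longrightarrow> pow m +> r n = pow m +> r m)"

text \<open>The index doubles as the modulus: \<open>r m\<close> counts only modulo
  \<open>pow m\<close>.\<close>

definition lim where "lim r = (\<lambda>m. pow m +> r m)"

lemma cauchyI:
  assumes "\<And>m. r m \<in> carrier R" "\<And>m n. m \<le> n \<Longrightarrow> pow m +> r n = pow m +> r m"
  shows "cauchy r"
  unfolding cauchy_def using assms by blast

lemma cauchy_carrier: "cauchy r \<Longrightarrow> r m \<in> carrier R"
  unfolding cauchy_def by blast

lemma cauchy_coset: "cauchy r \<Longrightarrow> m \<le> n \<Longrightarrow> pow m +> r n = pow m +> r m"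
  unfolding cauchy_def by blast

lemma lim_closed:
  assumes "cauchy r"
  shows "lim r \<in> carrier A"
proof -
  have "pow m +> r m = pow m <+>\<^bsub>R\<^esub> (pow n +> r n)" if "m \<le> n" for m n
    using transition_coset[OF that cauchy_carrier[OF assms]] cauchy_coset[OF assms that] by simp
  then show ?thesis
    using cauchy_carrier[OF assms]
    by (simp add: completion_def lim_def FactRing_def a_rcosetsI pow.a_subset)
qed

text \<open>A representative is chosen in each coset, and compatibility of the cosets becomes the
  Cauchy condition. Identities in the completion thereby reduce to termwise identities in
  \<open>R\<close>.\<close>

lemma completion_cases:
  assumes "x \<in> carrier A"
  obtains r where "cauchy r" "x = lim r"
proof -
  have x: "x m \<in> a_rcosets (pow m)" "m \<le> n \<Longrightarrow> x m = pow m <+>\<^bsub>R\<^esub> x n" for m n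
    using assms by (auto simp: completion_def FactRing_def)
  have "\<forall>m. \<exists>r\<in>carrier R. x m = pow m +> r" using x(1) by (auto simp: A_RCOSETS_def')
  then obtain r where r: "\<And>m. r m \<in> carrier R" "\<And>m. x m = pow m +> r m" by metis
  have "pow m +> r n = pow m +> r m" if "m \<le> n" for m n
    using x(2)[OF that] r that by (simp add: transition_coset)
  then have "cauchy r" by (rule cauchyI[OF r(1)])
  moreover have "x = lim r" using r by (simp add: lim_def fun_eq_iff)
  ultimately show ?thesis using that by blast
qed

lemma lim_eqI:
  "(\<And>m. pow m +> r m = pow m +> s m) \<Longrightarrow> lim r = lim s"
  by (simp add: lim_def fun_eq_iff)

lemma lim_add: "cauchy r \<Longrightarrow> cauchy s \<Longrightarrow> lim r \<oplus>\<^bsub>A\<^esub> lim s = lim (\<lambda>m. r m \<oplus> s m)"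
  by (simp add: completion_def lim_def FactRing_def pow.a_rcos_sum cauchy_carrier)

lemma lim_mult: "cauchy r \<Longrightarrow> cauchy s \<Longrightarrow> lim r \<otimes>\<^bsub>A\<^esub> lim s = lim (\<lambda>m. r m \<otimes> s m)"
  by (simp add: completion_def lim_def FactRing_def pow.rcoset_mult_add cauchy_carrier)

lemma lim_one: "\<one>\<^bsub>A\<^esub> = lim (\<lambda>_. \<one>)"
  by (simp add: completion_def lim_def FactRing_def)

lemma lim_zero: "\<zero>\<^bsub>A\<^esub> = lim (\<lambda>_. \<zero>)"
  by (simp add: completion_def lim_def FactRing_def pow.a_subset)

lemma to_completion_eq_lim: "\<iota> r = lim (\<lambda>_. r)"
  by (simp add: to_completion_def lim_def)

lemma cauchy_const: "r \<in> carrier R \<Longrightarrow> cauchy (\<lambda>_. r)"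
  by (simp add: cauchyI)

lemma cauchy_add:
  assumes "cauchy r" "cauchy s"
  shows "cauchy (\<lambda>m. r m \<oplus> s m)"
proof (rule cauchyI)
  show "pow m +> (r n \<oplus> s n) = pow m +> (r m \<oplus> s m)" if "m \<le> n" for m n
    using assms[THEN cauchy_coset, OF that] assms[THEN cauchy_carrier] by (metis pow.a_rcos_sum)
qed (use assms[THEN cauchy_carrier] in blast)

lemma cauchy_mult:
  assumes "cauchy r" "cauchy s"
  shows "cauchy (\<lambda>m. r m \<otimes> s m)"
proof (rule cauchyI)
  show "pow m +> (r n \<otimes> s n) = pow m +> (r m \<otimes> s m)" if "m \<le> n" for m n
    using assms[THEN cauchy_coset, OF that] assms[THEN cauchy_carrier] by (metis pow.rcoset_mult_add)
qed (use assms[THEN cauchy_carrier] in blast)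

lemma cauchy_minus:
  assumes "cauchy r"
  shows "cauchy (\<lambda>m. \<ominus> r m)"
proof -
  have "cauchy (\<lambda>m. (\<ominus> \<one>) \<otimes> r m)" using assms by (intro cauchy_mult cauchy_const) simp_all
  then show ?thesis using assms by (simp add: l_minus cauchy_carrier)
qed

lemmas lim_simps = lim_add lim_mult lim_one lim_zero cauchy_const cauchy_add cauchy_mult
  cauchy_minus cauchy_carrier lim_closed

section \<open>The ring structure of the completion\<close>

lemma ring_completion: "ring A"
proof (rule ringI)
  show "abelian_group A"
  proof (rule abelian_groupI)
    fix x assume "x \<in> carrier A"
    then obtain r where "cauchy r" "x = lim r" by (rule completion_cases)
    then show "\<exists>y\<in>carrier A. y \<oplus>\<^bsub>A\<^esub> x = \<zero>\<^bsub>A\<^esub>"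
      by (intro bexI[of _ "lim (\<lambda>m. \<ominus> r m)"]) (simp_all add: lim_simps l_neg)
  qed (auto elim!: completion_cases simp: lim_simps a_ac)
  show "monoid A"
    by (rule monoidI) (auto elim!: completion_cases simp: lim_simps m_assoc)
qed (auto elim!: completion_cases simp: lim_simps l_distr r_distr)

sublocale A: ring A by (rule ring_completion)

lemma to_completion_hom: "\<iota> \<in> ring_hom R A"
  by (rule ring_hom_memI) (simp_all add: to_completion_eq_lim lim_simps)

sublocale \<iota>: ring_hom_ring R A \<iota>
  by (intro ring_hom_ringI2 ring_axioms ring_completion to_completion_hom)

section \<open>The closed ideal and the quasi-inverses of its elements\<close>

lemma ideal_closure_eq: "J = {x \<in> carrier A. x 1 = I}"
  by (simp add: ideal_closure_def a_kernel_def' FactRing_def)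

text \<open>It is the kernel of evaluation at index 1, a ring homomorphism to
  \<open>R/I\<close>.\<close>

lemma ideal_ideal_closure: "ideal J A"
proof -
  have "x m \<in> carrier (R Quot pow m)" if "x \<in> carrier A" for x m
    using that unfolding completion_def by simp
  from this[of _ 1] have "(\<lambda>x. x 1) \<in> ring_hom A (R Quot I)"
    by (intro ring_hom_memI) (simp_all add: completion_def)
  then have "ring_hom_ring A (R Quot I) (\<lambda>x. x 1)"
    by (intro ring_hom_ringI2 ring_completion quotient_is_ring)
  then show ?thesis unfolding ideal_closure_def by (rule ring_hom_ring.kernel_is_ideal)
qed

text \<open>The term \<open>r 0\<close> counts only modulo \<open>pow 0\<close>, the whole ring, and
  may lie outside \<open>I\<close>. The sequence shifted by one has the same limit, and all its
  terms lie in \<open>I\<close>.\<close>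

lemma ideal_closure_cases:
  assumes "x \<in> J"
  obtains r where "cauchy r" "x = lim r" "\<And>m. r m \<in> I"
proof -
  obtain r where r: "cauchy r" "x = lim r"
    using assms completion_cases by (auto simp: ideal_closure_eq)
  have shift: "pow m +> r (Suc n) = pow m +> r m" if "m \<le> n" for m n
    using cauchy_coset[OF r(1) le_SucI[OF that]] .
  have "I +> r 1 = I" using assms r(2) by (simp add: ideal_closure_eq lim_def)
  then have "I +> r (Suc m) = I" for m
    using cauchy_coset[OF r(1), of 1 "Suc m"] by simp
  then have "r (Suc m) \<in> I" for m
    using a_rcos_self[OF cauchy_carrier[OF r(1)], of "Suc m"] by simp
  moreover have "cauchy (\<lambda>m. r (Suc m))"
    by (intro cauchyI cauchy_carrier[OF r(1)]) (metis shift order_refl)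
  moreover have "x = lim (\<lambda>m. r (Suc m))"
    unfolding r(2) by (rule lim_eqI) (rule shift[OF order_refl, symmetric])
  ultimately show ?thesis using that by blast
qed

text \<open>The partial sum \<open>a + a^2 + ... + a^k\<close> in Horner form, so that its recursion
  has the shape of the quasi-inverse equation.\<close>

primrec geometric where
  "geometric a 0 = \<zero>"
| "geometric a (Suc k) = a \<oplus> geometric a k \<otimes> a"

lemma geometric_closed [simp]: "a \<in> carrier R \<Longrightarrow> geometric a k \<in> carrier R"
  by (induction k) auto

lemma geometric_commute: "a \<in> carrier R \<Longrightarrow> geometric a k \<otimes> a = a \<otimes> geometric a k"
  by (induction k) (auto simp: l_distr r_distr m_assoc)

text \<open>The difference is \<open>a^(k+1)\<close>; each further difference is the preceding one
  times \<open>a\<close>.\<close>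

lemma geometric_step:
  assumes "a \<in> I"
  shows "geometric a (Suc k) \<ominus> geometric a k \<in> pow (Suc k)"
proof (induction k)
  case 0
  then show ?case using assms Icarr[OF assms] by (simp add: minus_eq)
next
  case (Suc k)
  have a: "a \<in> carrier R" using assms by (rule Icarr)
  have "geometric a (Suc (Suc k)) \<ominus> geometric a (Suc k)
      = (geometric a (Suc k) \<ominus> geometric a k) \<otimes> a"
  proof -
    have "(a \<oplus> g \<otimes> a) \<ominus> (a \<oplus> h \<otimes> a) = (g \<ominus> h) \<otimes> a"
      if "g \<in> carrier R" "h \<in> carrier R" for g h using a that by algebra
    from this[of "geometric a (Suc k)" "geometric a k"] show ?thesis
      using a by (simp only: geometric.simps geometric_closed m_closed a_closed)
  qed
  then show ?case using pow_mult[OF Suc.IH assms] by simp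
qed

text \<open>The powers of \<open>a\<close> beyond the \<open>m\<close>-th vanish modulo
  \<open>pow m\<close>.\<close>

lemma geometric_stable:
  assumes "a \<in> I" "m \<le> n"
  shows "pow m +> geometric a n = pow m +> geometric a m"
  using assms(2)
proof (induction n rule: dec_induct)
  case (step n)
  have "geometric a (Suc n) \<ominus> geometric a n \<in> pow m"
    using geometric_step[OF assms(1), of n] pow_antimono[of m "Suc n"] step.hyps by auto
  then have "pow m +> geometric a (Suc n) = pow m +> geometric a n"
    by (subst coset_eq_iff) (use Icarr[OF assms(1)] geometric_closed in blast)+
  then show ?case using step.IH by simp
qed simp

text \<open>A partial sum is a polynomial in \<open>a\<close> and so is compatible with
  cosets.\<close>

lemma geometric_cong:
  assumes "a \<in> carrier R" "b \<in> carrier R" "pow m +> a = pow m +> b"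
  shows "pow m +> geometric a k = pow m +> geometric b k"
  using assms
  by (induction k) (simp_all add: pow.a_rcos_sum[symmetric] pow.rcoset_mult_add[symmetric])

text \<open>The quasi-inverse is the series \<open>x + x^2 + x^3 + ...\<close>, which converges
  because \<open>x\<close> has representatives in \<open>I\<close>.\<close>

lemma ideal_closure_quasi_regular:
  assumes "x \<in> J"
  shows "\<exists>s\<in>carrier A. s = x \<oplus>\<^bsub>A\<^esub> x \<otimes>\<^bsub>A\<^esub> s \<and> s = x \<oplus>\<^bsub>A\<^esub> s \<otimes>\<^bsub>A\<^esub> x"
proof -
  obtain r where r: "cauchy r" "x = lim r" "\<And>m. r m \<in> I"
    using ideal_closure_cases[OF assms] by blast
  \<comment> \<open>A diagonal choice: modulo \<open>pow m\<close> the series is given by the first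
    \<open>m\<close> powers of the \<open>m\<close>-th representative. To compare indices
    \<open>m \<le> n\<close>, the length is reduced first and the representative second.\<close>
  define g where "g m = geometric (r m) m" for m
  have g_closed: "g m \<in> carrier R" for m using cauchy_carrier[OF r(1)] by (simp add: g_def)
  have "pow m +> g n = pow m +> g m" if "m \<le> n" for m n
  proof -
    have "pow m +> g n = pow m +> geometric (r n) m"
      unfolding g_def using r(3) that by (rule geometric_stable)
    also have "\<dots> = pow m +> g m"
      unfolding g_def using cauchy_carrier[OF r(1)] cauchy_coset[OF r(1) that]
      by (intro geometric_cong)
    finally show ?thesis .
  qed
  then have g: "cauchy g" by (rule cauchyI[OF g_closed])
  \<comment> \<open>The term \<open>r m + g m r m\<close> is the partial sum of length
    \<open>m + 1\<close>, which agrees with \<open>g m\<close> modulo \<open>pow m\<close>.\<close>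
  have "lim g = lim (\<lambda>m. r m \<oplus> g m \<otimes> r m)"
    unfolding g_def geometric.simps(2)[symmetric]
    by (rule lim_eqI) (simp only: geometric_stable[OF r(3) le_SucI[OF order_refl]])
  also have "\<dots> = x \<oplus>\<^bsub>A\<^esub> lim g \<otimes>\<^bsub>A\<^esub> x" using r(1,2) g by (simp add: lim_simps)
  finally have "lim g = x \<oplus>\<^bsub>A\<^esub> lim g \<otimes>\<^bsub>A\<^esub> x" .
  moreover have "lim g \<otimes>\<^bsub>A\<^esub> x = x \<otimes>\<^bsub>A\<^esub> lim g"
    unfolding r(2) lim_mult[OF g r(1)] lim_mult[OF r(1) g]
    using cauchy_carrier[OF r(1)] by (simp add: g_def geometric_commute)
  ultimately show ?thesis using lim_closed[OF g] by metis
qed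

lemma to_completion_mem_ideal_closure_iff:
  assumes "r \<in> carrier R"
  shows "\<iota> r \<in> J \<longleftrightarrow> r \<in> I"
proof -
  have "\<iota> r \<in> J \<longleftrightarrow> I +> r = I"
    using \<iota>.hom_closed[OF assms] by (simp add: ideal_closure_eq) (simp add: to_completion_def)
  then show ?thesis using a_rcos_self[OF assms] a_rcos_const by auto
qed

lemma to_completion_image_ideal: "\<iota> ` carrier R \<inter> J = \<iota> ` I"
  using to_completion_mem_ideal_closure_iff a_subset by auto

sublocale completion: quasi_regular_ideal_subring J A "\<iota> ` carrier R"
proof -
  have "subring (\<iota> ` carrier R) A"
    using \<iota>.img_is_subring[OF carrier_is_subring] .
  then show "quasi_regular_ideal_subring J A (\<iota> ` carrier R)"
    using ideal_ideal_closure ideal_closure_quasi_regular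
    by (simp add: quasi_regular_ideal_subring_def quasi_regular_ideal_def quasi_regular_ideal_axioms_def)
qed

section \<open>Column and row systems over \<open>R\<close>\<close>

lemma column_solution_iff:
  "column_solution R I l P Q Z \<longleftrightarrow>
    Z \<in> {..<l} \<rightarrow>\<^sub>E carrier A \<and> linear_solution A l (\<lambda>i. \<iota> (P i)) (\<lambda>i j. \<iota> (Q i j)) Z"
  by (simp add: column_solution_def linear_solution_def)

text \<open>Reversing the factors turns a row system into the column system of the transposed
  matrix.\<close>

lemma row_solution_iff:
  "row_solution R I l P Q Z \<longleftrightarrow>
    Z \<in> {..<l} \<rightarrow>\<^sub>E carrier A \<and> linear_solution (opposite A) l (\<lambda>i. \<iota> (P i)) (\<lambda>i j. \<iota> (Q j i)) Z"
  by (simp add: row_solution_def linear_solution_def)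

text \<open>The ring \<open>A'\<close> will be the completion or its opposite, which share the
  carrier, so that columns and rows are treated at once.\<close>

lemma solution_entries_to_completion:
  assumes "ring A'" and A': "carrier A' = carrier A"
  shows "solution_entries A' J (\<iota> ` carrier R) =
    {Z i | l P Q Z i. 0 < l \<and> P \<in> {..<l} \<rightarrow> carrier R \<and> Q \<in> {..<l} \<rightarrow> {..<l} \<rightarrow> I \<and>
       (Z \<in> {..<l} \<rightarrow>\<^sub>E carrier A \<and> linear_solution A' l (\<lambda>i. \<iota> (P i)) (\<lambda>i j. \<iota> (Q i j)) Z) \<and> i < l}"
    (is "_ = ?E")
proof (intro equalityI subsetI)
  interpret A': ring A' by fact
  fix x assume "x \<in> solution_entries A' J (\<iota> ` carrier R)"
  then obtain l P Q Z i where P: "P \<in> {..<l} \<rightarrow> \<iota> ` carrier R"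
    and Q: "Q \<in> {..<l} \<rightarrow> {..<l} \<rightarrow> \<iota> ` I"
    and Z: "Z \<in> {..<l} \<rightarrow> carrier A" "linear_solution A' l P Q Z" and i: "i < l" "x = Z i"
    unfolding solution_entries_def to_completion_image_ideal A' by blast
  \<comment> \<open>Preimages of the coefficients are chosen; only their images enter the
    system.\<close>
  define P' where "P' i = inv_into (carrier R) \<iota> (P i)" for i
  define Q' where "Q' i j = inv_into I \<iota> (Q i j)" for i j
  have P': "P' \<in> {..<l} \<rightarrow> carrier R" and \<iota>P': "\<And>i. i < l \<Longrightarrow> \<iota> (P' i) = P i"
    using P by (auto simp: P'_def Pi_iff intro!: inv_into_into f_inv_into_f)
  have Q': "Q' \<in> {..<l} \<rightarrow> {..<l} \<rightarrow> I" and \<iota>Q': "\<And>i j. i < l \<Longrightarrow> j < l \<Longrightarrow> \<iota> (Q' i j) = Q i j"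
    using Q by (auto simp: Q'_def Pi_iff intro!: inv_into_into f_inv_into_f)
  have "\<iota> ` I \<subseteq> carrier A" using a_subset by auto
  then have "linear_solution A' l (\<lambda>i. \<iota> (P' i)) (\<lambda>i j. \<iota> (Q' i j)) (restrict Z {..<l})
      \<longleftrightarrow> linear_solution A' l P Q Z"
    using P Q Z(1) \<iota>P' \<iota>Q'
    by (intro A'.linear_solution_cong) (fastforce simp: A' Pi_iff)+
  moreover have "restrict Z {..<l} \<in> {..<l} \<rightarrow>\<^sub>E carrier A" using Z(1) by auto
  moreover have "x = restrict Z {..<l} i" using i by simp
  ultimately show "x \<in> ?E" using P' Q' Z(2) i(1) gr_zeroI
    by (intro CollectI exI[of _ l] exI[of _ P'] exI[of _ Q'] exI[of _ "restrict Z {..<l}"] exI[of _ i])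
      auto
next
  fix x assume "x \<in> ?E"
  then obtain l P Q Z i where P: "P \<in> {..<l} \<rightarrow> carrier R" and Q: "Q \<in> {..<l} \<rightarrow> {..<l} \<rightarrow> I"
    and Z: "Z \<in> {..<l} \<rightarrow>\<^sub>E carrier A" "linear_solution A' l (\<lambda>i. \<iota> (P i)) (\<lambda>i j. \<iota> (Q i j)) Z"
    and i: "i < l" "x = Z i" by blast
  moreover have "(\<lambda>i. \<iota> (P i)) \<in> {..<l} \<rightarrow> \<iota> ` carrier R" using P by auto
  moreover have "(\<lambda>i j. \<iota> (Q i j)) \<in> {..<l} \<rightarrow> {..<l} \<rightarrow> \<iota> ` I" using Q by (auto simp: Pi_iff)
  moreover have "Z \<in> {..<l} \<rightarrow> carrier A'" using Z(1) A' by (auto simp: PiE_iff)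
  ultimately show "x \<in> solution_entries A' J (\<iota> ` carrier R)"
    unfolding solution_entries_def to_completion_image_ideal by blast
qed

lemma ex1_column_solution:
  assumes "P \<in> {..<l} \<rightarrow> carrier R" "Q \<in> {..<l} \<rightarrow> {..<l} \<rightarrow> I"
  shows "\<exists>!Z. column_solution R I l P Q Z"
  unfolding column_solution_iff
  using assms to_completion_image_ideal
  by (intro completion.ex1_linear_solution) (auto simp: Pi_iff)

lemma ex1_row_solution:
  assumes "P \<in> {..<l} \<rightarrow> carrier R" "Q \<in> {..<l} \<rightarrow> {..<l} \<rightarrow> I"
  shows "\<exists>!Z. row_solution R I l P Q Z"
proof -
  interpret op: quasi_regular_ideal_subring J "opposite A" "\<iota> ` carrier R"
    by (rule completion.opposite)
  show ?thesis
    unfolding row_solution_iff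
    using assms to_completion_image_ideal
    by (intro op.ex1_linear_solution[simplified opposite_simps]) (auto simp: Pi_iff)
qed

lemma Inter_rationally_closed_column:
  "\<Inter>{S. rationally_closed A J (\<iota> ` carrier R) S} =
    {Z i | l P Q Z i. 0 < l \<and> P \<in> {..<l} \<rightarrow> carrier R \<and> Q \<in> {..<l} \<rightarrow> {..<l} \<rightarrow> I \<and>
       column_solution R I l P Q Z \<and> i < l}"
  unfolding completion.Inter_rationally_closed column_solution_iff
  by (rule solution_entries_to_completion[OF ring_completion refl])

text \<open>A ring and its opposite have the same rationally closed subsets, so the column
  description over the opposite ring describes the same intersection.\<close>

lemma Inter_rationally_closed_row:
  "\<Inter>{S. rationally_closed A J (\<iota> ` carrier R) S} =
    {Z i | l P Q Z i. 0 < l \<and> P \<in> {..<l} \<rightarrow> carrier R \<and> Q \<in> {..<l} \<rightarrow> {..<l} \<rightarrow> I \<and>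
       row_solution R I l P Q Z \<and> i < l}" (is "?L = ?R")
proof -
  have "?L = solution_entries (opposite A) J (\<iota> ` carrier R)"
    using quasi_regular_ideal_subring.Inter_rationally_closed[OF completion.opposite] by simp
  also have "\<dots> = {Z i | l P Q Z i. 0 < l \<and> P \<in> {..<l} \<rightarrow> carrier R \<and> Q \<in> {..<l} \<rightarrow> {..<l} \<rightarrow> I \<and>
       row_solution R I l P (\<lambda>i j. Q j i) Z \<and> i < l}"
    unfolding row_solution_iff
    by (rule solution_entries_to_completion[OF A.ring_opposite]) simp
  \<comment> \<open>Transposition is an involution on the matrices over \<open>I\<close>, hence it
    is absorbed by the choice of \<open>Q\<close>.\<close>
  also have "\<dots> = ?R"
  proof (intro equalityI subsetI; elim CollectE exE conjE)
    fix x P Q and l i :: nat and Z :: "nat \<Rightarrow> nat \<Rightarrow> 'a set"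
    assume *: "x = Z i" "0 < l" "P \<in> {..<l} \<rightarrow> carrier R" "Q \<in> {..<l} \<rightarrow> {..<l} \<rightarrow> I" "i < l"
    have Q: "(\<lambda>i j. Q j i) \<in> {..<l} \<rightarrow> {..<l} \<rightarrow> I" using *(4) by (auto simp: Pi_iff)
    show "x \<in> ?R" if "row_solution R I l P (\<lambda>i j. Q j i) Z"
      using * that Q by blast
    show "x \<in> {Z i | l P Q Z i. 0 < l \<and> P \<in> {..<l} \<rightarrow> carrier R \<and> Q \<in> {..<l} \<rightarrow> {..<l} \<rightarrow> I \<and>
        row_solution R I l P (\<lambda>i j. Q j i) Z \<and> i < l}" if "row_solution R I l P Q Z"
      using * that Q
      by (intro CollectI exI[of _ l] exI[of _ P] exI[of _ "\<lambda>i j. Q j i"] exI[of _ Z] exI[of _ i]) simp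
  qed
  finally show ?thesis .
qed

end

section \<open>Scalars and the rational closure\<close>

text \<open>Closure under scalars is automatic, since \<open>a x = (a 1) x\<close> and \<open>a 1\<close> lies in the image of \<open>R\<close>.\<close>

locale adic_algebra = assoc_algebra K R + adic I R
  for K :: "('k, 'c) ring_scheme" and R :: "('k, 'a, 'm) module_scheme" (structure) and I
begin

text \<open>On representatives \<open>a\<close> acts as multiplication by
  \<open>a \<odot> \<one>\<close>, and an error \<open>k\<close> in \<open>pow m\<close> becomes
  \<open>(a \<odot> \<one>) \<otimes> k\<close>, again in \<open>pow m\<close>.\<close>

lemma smult_completion:
  assumes "a \<in> carrier K" "x \<in> carrier A"
  shows "a \<odot>\<^bsub>A\<^esub> x = \<iota> (a \<odot> \<one>) \<otimes>\<^bsub>A\<^esub> x"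
proof -
  obtain r where r: "cauchy r" "x = lim r" using assms(2) by (rule completion_cases)
  have eq: "a \<odot> y = (a \<odot> \<one>) \<otimes> y" if "y \<in> carrier R" for y
    using assms(1) that by (simp add: smult_mult_left)
  have a1: "a \<odot> \<one> \<in> carrier R" using assms(1) by simp
  have "pow m <+>\<^bsub>R\<^esub> ((\<lambda>y. a \<odot> y) ` (pow m +> r m)) = pow m +> (a \<odot> \<one>) \<otimes> r m" for m
  proof
    have rm: "r m \<in> carrier R" using r(1) by (rule cauchy_carrier)
    have "h \<oplus> a \<odot> (k \<oplus> r m) \<in> pow m +> (a \<odot> \<one>) \<otimes> r m" if "h \<in> pow m" "k \<in> pow m" for h k
    proof -
      have "h \<oplus> a \<odot> (k \<oplus> r m) = (h \<oplus> (a \<odot> \<one>) \<otimes> k) \<oplus> (a \<odot> \<one>) \<otimes> r m"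
        using that rm a1 by (simp add: eq[of "k \<oplus> r m"] pow.Icarr r_distr a_assoc)
      moreover have "h \<oplus> (a \<odot> \<one>) \<otimes> k \<in> pow m" using that a1 by (simp add: pow.I_l_closed)
      ultimately show ?thesis by (auto simp: a_r_coset_def')
    qed
    then show "pow m <+>\<^bsub>R\<^esub> ((\<lambda>y. a \<odot> y) ` (pow m +> r m)) \<subseteq> pow m +> (a \<odot> \<one>) \<otimes> r m"
      by (auto simp: set_add_def' a_r_coset_def'[of R "pow m" "r m"])
    have "a \<odot> r m \<in> (\<lambda>y. a \<odot> y) ` (pow m +> r m)" using pow.a_rcos_self[OF rm] by blast
    then show "pow m +> (a \<odot> \<one>) \<otimes> r m \<subseteq> pow m <+>\<^bsub>R\<^esub> ((\<lambda>y. a \<odot> y) ` (pow m +> r m))"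
      unfolding eq[OF rm, symmetric] set_add_def' a_r_coset_def'[of R "pow m" "a \<odot> r m"] by blast
  qed
  then have "a \<odot>\<^bsub>A\<^esub> x = lim (\<lambda>m. (a \<odot> \<one>) \<otimes> r m)"
    by (simp add: r(2) lim_def completion_def)
  then show ?thesis using r a1 by (simp add: to_completion_eq_lim lim_simps)
qed

lemma is_subalgebra_iff:
  assumes "\<iota> ` carrier R \<subseteq> S"
  shows "is_subalgebra S K A \<longleftrightarrow> subring S A"
proof -
  have "submodule S K A" if "subring S A"
  proof -
    have "a \<odot>\<^bsub>A\<^esub> x \<in> S" if "a \<in> carrier K" "x \<in> S" for a x
    proof -
      have "x \<in> carrier A" using that(2) subringE(1)[OF \<open>subring S A\<close>] by blast
      moreover have "\<iota> (a \<odot> \<one>) \<in> S"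
        using that(1) by (intro subsetD[OF assms] imageI) simp
      ultimately show ?thesis
        using smult_completion[OF that(1)] subringE(6)[OF \<open>subring S A\<close>] that(2) by simp
    qed
    then show ?thesis
      using subring.axioms(1)[OF that] by (simp add: submodule_def submodule_axioms_def)
  qed
  then show ?thesis by (auto simp: is_subalgebra_def)
qed

lemma rational_closure_eq: "rational_closure K R I = \<Inter>{S. rationally_closed A J (\<iota> ` carrier R) S}"
proof -
  have "is_subalgebra S K A \<and> \<iota> ` carrier R \<subseteq> S \<and> (\<forall>r\<in>S \<inter> J. quasi_inverse A r \<in> S) \<longleftrightarrow>
      rationally_closed A J (\<iota> ` carrier R) S" for S
    using is_subalgebra_iff[of S] by (auto simp: rationally_closed_def)
  then show ?thesis by (simp add: rational_closure_def)
qed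

end

theorem proposition3p5:
  fixes K :: "('k, 'c) ring_scheme" and R :: "('k, 'a, 'm) module_scheme" and I :: "'a set"
  assumes "assoc_algebra K R"
    and "ideal I R"
    and "transfinitely_nilpotent R I"
  shows
    "(\<forall>l>0. \<forall>P \<in> {..<l} \<rightarrow> carrier R. \<forall>Q \<in> {..<l} \<rightarrow> {..<l} \<rightarrow> I.
        \<exists>!Z. column_solution R I l P Q Z) \<and>
     rational_closure K R I =
       {Z i | l P Q Z i. 0 < l \<and> P \<in> {..<l} \<rightarrow> carrier R \<and> Q \<in> {..<l} \<rightarrow> {..<l} \<rightarrow> I \<and>
          column_solution R I l P Q Z \<and> i < l} \<and>
     (\<forall>l>0. \<forall>P \<in> {..<l} \<rightarrow> carrier R. \<forall>Q \<in> {..<l} \<rightarrow> {..<l} \<rightarrow> I.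
        \<exists>!Z. row_solution R I l P Q Z) \<and>
     rational_closure K R I =
       {Z i | l P Q Z i. 0 < l \<and> P \<in> {..<l} \<rightarrow> carrier R \<and> Q \<in> {..<l} \<rightarrow> {..<l} \<rightarrow> I \<and>
          row_solution R I l P Q Z \<and> i < l}"
proof -
  interpret adic_algebra K R I
    using assms(1,2) by (simp add: adic_algebra_def adic_def)
  show ?thesis
    unfolding rational_closure_eq
    by (intro conjI allI ballI impI ex1_column_solution ex1_row_solution
        Inter_rationally_closed_column Inter_rationally_closed_row)
qed

end
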